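(* Let $k$ be a positive integer, let $B$ be a non-zero real constant, and consider the equation $$u_{n+4k}=\frac{u_n}{1+B\prod_{i=1}^{k}u_{n+4(i-1)}},\qquad n\ge 0.$$ The zero equilibrium point $\bar u=0$ is non-hyperbolic. Furthermore, if $(u_n)_{n\ge0}$ is a solution whose initial conditions $u_i$, $i=0,\dots,4k-1$, are positive, and $B$ is positive, then $u_n$ converges to the zero equilibrium point, i.e. $\lim_{n\to\infty}u_n=0$.
   Context: Write the equation as $u_{n+4k}=f(u_n,u_{n+4},\dots,u_{n+4k-4})$. An equilibrium point is a number $\bar u$ with $\bar u=f(\bar u,\dots,\bar u)$. Put $p_i=\frac{\partial f}{\partial u_{n+i}}(\bar u,\dots,\bar u)$ for $i=4r$, $r=0,1,\dots,k-1$. The characteristic equation about $\bar u$ is $$\lambda^{4k}-p_{4k-4}\lambda^{4k-4}-\dots-p_4\lambda^4-p_0=0.$$ The equilibrium point $\bar u$ is called non-hyperbolic if this equation has a (complex) root of absolute value equal to one. *)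

theory Defs
  imports Complex_Main "HOL-Analysis.Derivative"
begin

text \<open>
  Difference equations \<open>u\<^sub>n\<^sub>+\<^sub>4\<^sub>k = f(u\<^sub>n, u\<^sub>n\<^sub>+\<^sub>4, \<dots>, u\<^sub>n\<^sub>+\<^sub>4\<^sub>k\<^sub>-\<^sub>4)\<close> of order \<open>4k\<close>. The right-hand side is
  \<open>f :: (nat \<Rightarrow> real) \<Rightarrow> real\<close>, where the argument at position \<open>r < k\<close> stands for the variable \<open>u\<^sub>n\<^sub>+\<^sub>4\<^sub>r\<close>;
  positions \<open>r \<ge> k\<close> are meant to be ignored by \<open>f\<close>.
\<close>

definition is_solution :: "nat \<Rightarrow> ((nat \<Rightarrow> real) \<Rightarrow> real) \<Rightarrow> (nat \<Rightarrow> real) \<Rightarrow> bool" where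
  "is_solution k f u \<longleftrightarrow> (\<forall>n. u (n + 4 * k) = f (\<lambda>r. u (n + 4 * r)))"

definition is_equilibrium :: "((nat \<Rightarrow> real) \<Rightarrow> real) \<Rightarrow> real \<Rightarrow> bool" where
  "is_equilibrium f ubar \<longleftrightarrow> ubar = f (\<lambda>_. ubar)"

definition slice :: "((nat \<Rightarrow> real) \<Rightarrow> real) \<Rightarrow> real \<Rightarrow> nat \<Rightarrow> real \<Rightarrow> real" where
  "slice f ubar r t = f ((\<lambda>_. ubar)(r := t))"

text \<open>\<open>char_coeff f ubar r\<close> is the coefficient \<open>p\<^sub>4\<^sub>r\<close>, i.e. the partial derivative of \<open>f\<close>
  with respect to \<open>u\<^sub>n\<^sub>+\<^sub>4\<^sub>r\<close> at \<open>(ubar, \<dots>, ubar)\<close>.\<close>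

definition char_coeff :: "((nat \<Rightarrow> real) \<Rightarrow> real) \<Rightarrow> real \<Rightarrow> nat \<Rightarrow> real" where
  "char_coeff f ubar r = deriv (slice f ubar r) ubar"

definition char_root :: "nat \<Rightarrow> ((nat \<Rightarrow> real) \<Rightarrow> real) \<Rightarrow> real \<Rightarrow> complex \<Rightarrow> bool" where
  "char_root k f ubar z \<longleftrightarrow>
     z ^ (4 * k) - (\<Sum>r<k. complex_of_real (char_coeff f ubar r) * z ^ (4 * r)) = 0"

text \<open>Differentiability of the slices is required explicitly, because \<open>deriv\<close> is a total
  function that has an unspecified value where no derivative exists.\<close>

definition non_hyperbolic :: "nat \<Rightarrow> ((nat \<Rightarrow> real) \<Rightarrow> real) \<Rightarrow> real \<Rightarrow> bool" where
  "non_hyperbolic k f ubar \<longleftrightarrow>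
     is_equilibrium f ubar \<and>
     (\<forall>r<k. slice f ubar r field_differentiable at ubar) \<and>
     (\<exists>z. cmod z = 1 \<and> char_root k f ubar z)"

definition rhs :: "nat \<Rightarrow> real \<Rightarrow> (nat \<Rightarrow> real) \<Rightarrow> real" where
  "rhs k B x = x 0 / (1 + B * (\<Prod>i=1..k. x (i - 1)))"

end

theory Submission
  imports Defs
begin

text \<open>
  At the zero equilibrium the denominator of the right-hand side is \<open>1\<close>, and every partial
  derivative vanishes except the one in the variable \<open>u\<^sub>n\<close>, which is \<open>1\<close>. The characteristic
  equation is therefore \<open>\<lambda>\<^sup>4\<^sup>k = 1\<close>, with the root \<open>\<lambda> = 1\<close> on the unit circle.

  For convergence, consider the product \<open>P\<^sub>n = u\<^sub>n u\<^sub>n\<^sub>+\<^sub>4 \<dots> u\<^sub>n\<^sub>+\<^sub>4\<^sub>k\<^sub>-\<^sub>4\<close> and the factor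
  \<open>x\<^sub>n = 1 / (1 + B P\<^sub>n)\<close>, so that the equation reads \<open>u\<^sub>n\<^sub>+\<^sub>4\<^sub>k = x\<^sub>n u\<^sub>n\<close>. Passing from \<open>P\<^sub>n\<close> to
  \<open>P\<^sub>n\<^sub>+\<^sub>4\<close> replaces the factor \<open>u\<^sub>n\<close> by \<open>u\<^sub>n\<^sub>+\<^sub>4\<^sub>k\<close>; hence \<open>P\<^sub>n\<^sub>+\<^sub>4 = x\<^sub>n P\<^sub>n\<close>, which is the statement
  that \<open>1 / P\<^sub>n\<^sub>+\<^sub>4 = 1 / P\<^sub>n + B\<close>. So \<open>1 / P\<^sub>n\<close> grows linearly and \<open>P\<^sub>n\<close> tends to zero.

  That the product tends to zero does not yet control each factor. But \<open>P\<close> decreases in steps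
  of four, so \<open>x\<close> increases in steps of four, and therefore
  \<open>x\<^sub>n\<^sup>k \<le> x\<^sub>n x\<^sub>n\<^sub>+\<^sub>4 \<dots> x\<^sub>n\<^sub>+\<^sub>4\<^sub>k\<^sub>-\<^sub>4 = P\<^sub>n\<^sub>+\<^sub>4\<^sub>k / P\<^sub>n\<close>. The left-hand side is \<open>(u\<^sub>n\<^sub>+\<^sub>4\<^sub>k / u\<^sub>n)\<^sup>k\<close>, so
  \<open>u\<^sub>n\<^sup>k / P\<^sub>n\<close> does not increase when \<open>n\<close> grows by \<open>4k\<close>. It is thus bounded by a constant \<open>C\<close>,
  and \<open>u\<^sub>n\<^sup>k \<le> C P\<^sub>n\<close> forces \<open>u\<^sub>n\<close> to zero.
\<close>

section \<open>Linearization at the zero equilibrium\<close>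

lemma rhs_lessThan: "rhs k B x = x 0 / (1 + B * (\<Prod>r<k. x r))"
proof -
  have "(\<Prod>i=1..k. x (i - 1)) = (\<Prod>r<k. x r)"
    by (rule prod.reindex_bij_witness[of _ Suc "\<lambda>i. i - 1"]) auto
  then show ?thesis
    by (simp add: rhs_def)
qed

lemma slice_rhs_first:
  assumes "k \<ge> 1"
  shows "slice (rhs k B) 0 0 = (\<lambda>t. t / (1 + B * (t * 0 ^ (k - 1))))"
proof
  fix t :: real
  obtain m where k: "k = Suc m"
    using assms by (cases k) auto
  show "slice (rhs k B) 0 0 t = t / (1 + B * (t * 0 ^ (k - 1)))"
    unfolding slice_def rhs_lessThan k prod.lessThan_Suc_shift by simp
qed

lemma slice_rhs_other:
  assumes "r \<noteq> 0"
  shows "slice (rhs k B) 0 r = (\<lambda>t. 0)"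
  using assms by (auto simp: slice_def rhs_lessThan fun_eq_iff)

lemma slice_rhs_has_derivative:
  assumes "k \<ge> 1"
  shows "(slice (rhs k B) 0 r has_field_derivative (if r = 0 then 1 else 0)) (at 0)"
proof (cases "r = 0")
  case True
  have "((\<lambda>t. t / (1 + B * (t * 0 ^ (k - 1)))) has_field_derivative 1) (at 0)"
    by (auto intro!: derivative_eq_intros)
  with True assms show ?thesis
    by (simp add: slice_rhs_first)
next
  case False
  then show ?thesis
    by (simp add: slice_rhs_other)
qed

lemma zero_is_equilibrium: "is_equilibrium (rhs k B) 0"
  by (simp add: is_equilibrium_def rhs_def)

lemma zero_non_hyperbolic:
  assumes "k \<ge> 1"
  shows "non_hyperbolic k (rhs k B) 0"
proof -
  have coeff: "char_coeff (rhs k B) 0 r = (if r = 0 then 1 else 0)" for r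
    unfolding char_coeff_def by (rule DERIV_imp_deriv[OF slice_rhs_has_derivative[OF assms]])
  have "(\<Sum>r<k. complex_of_real (char_coeff (rhs k B) 0 r) * 1 ^ (4 * r))
      = (\<Sum>r<k. if r = 0 then 1 else 0)"
    by (intro sum.cong) (auto simp: coeff)
  also have "\<dots> = (1 :: complex)"
    using assms by simp
  finally have "(\<Sum>r<k. complex_of_real (char_coeff (rhs k B) 0 r) * 1 ^ (4 * r)) = (1 :: complex)" .
  then have "char_root k (rhs k B) 0 1"
    by (simp add: char_root_def)
  moreover have "slice (rhs k B) 0 r field_differentiable at 0" for r
    using slice_rhs_has_derivative[OF assms] by (auto simp: field_differentiable_def)
  ultimately show ?thesis
    unfolding non_hyperbolic_def using zero_is_equilibrium by (metis norm_one)
qed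

section \<open>Convergence of positive solutions\<close>

locale positive_solution =
  fixes k :: nat and B :: real and u :: "nat \<Rightarrow> real"
  assumes k_pos: "k \<ge> 1" and B_pos: "B > 0"
    and solution: "is_solution k (rhs k B) u"
    and initial_pos: "\<And>i. i < 4 * k \<Longrightarrow> u i > 0"
begin

definition window :: "nat \<Rightarrow> real" where
  "window n = (\<Prod>r<k. u (n + 4 * r))"

definition shrink :: "nat \<Rightarrow> real" where
  "shrink n = 1 / (1 + B * window n)"

lemma step: "u (n + 4 * k) = shrink n * u n"
  using solution by (simp add: is_solution_def rhs_lessThan window_def shrink_def)

lemma u_pos: "u n > 0"
proof (induction n rule: less_induct)
  case (less n)
  show ?case
  proof (cases "n < 4 * k")
    case True
    then show ?thesis by (rule initial_pos)
  next
    case False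
    define m where "m = n - 4 * k"
    have n: "n = m + 4 * k"
      using False by (simp add: m_def)
    have "window m > 0"
      unfolding window_def using less.IH by (intro prod_pos) (simp add: n)
    then have "shrink m > 0"
      using B_pos by (simp add: shrink_def add_pos_pos)
    moreover have "u m > 0"
      using less.IH[of m] k_pos by (simp add: n)
    ultimately show ?thesis
      by (simp add: n step)
  qed
qed

lemma window_pos: "window n > 0"
  unfolding window_def using u_pos by (intro prod_pos) simp

lemma shrink_pos: "shrink n > 0"
  using window_pos[of n] B_pos by (simp add: shrink_def add_pos_pos)

lemma shrink_le_1: "shrink n \<le> 1"
  using window_pos[of n] B_pos by (simp add: shrink_def divide_le_eq_1 add_pos_pos)

text \<open>
  The window at \<open>n + 4\<close> loses the factor \<open>u n\<close> and gains \<open>u (n + 4 * k)\<close>, and the ratio of these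
  two is exactly the shrink factor of the equation.
\<close>

lemma window_step: "window (n + 4) = shrink n * window n"
proof -
  have "window (n + 4) * u n = (\<Prod>r<Suc k. u (n + 4 * r))"
    unfolding window_def prod.lessThan_Suc_shift by (simp add: add_ac)
  also have "\<dots> = window n * (shrink n * u n)"
    by (simp add: window_def step)
  finally show ?thesis
    using u_pos[of n] by simp
qed

lemma inverse_window_step: "inverse (window (n + 4)) = inverse (window n) + B"
proof -
  have "1 + B * window n > 0"
    using window_pos[of n] B_pos by (simp add: add_pos_pos)
  then show ?thesis
    using window_pos[of n] by (simp add: window_step shrink_def field_simps)
qed

text \<open>
  The shift by four makes the bound trivial at the four starting indices \<open>n < 4\<close>, where nothing
  better than positivity of the window is known.
\<close>

lemma inverse_window_ge: "B * (real n - 4) / 4 \<le> inverse (window n)"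
proof (induction n rule: less_induct)
  case (less n)
  show ?case
  proof (cases "n < 4")
    case True
    then have "B * (real n - 4) \<le> 0"
      using B_pos by (simp add: mult_le_0_iff)
    moreover have "inverse (window n) > 0"
      using window_pos by simp
    ultimately show ?thesis by linarith
  next
    case False
    define m where "m = n - 4"
    have n: "n = m + 4"
      using False by (simp add: m_def)
    have "B * (real m - 4) / 4 \<le> inverse (window m)"
      by (rule less.IH) (simp add: n)
    then show ?thesis
      unfolding n inverse_window_step by (simp add: field_simps)
  qed
qed

lemma window_tendsto_0: "window \<longlonglongrightarrow> 0"
proof -
  have "filterlim (\<lambda>n. B / 4 * (real n - 4)) at_top sequentially"
    using B_pos
    by (intro filterlim_tendsto_pos_mult_at_top[OF tendsto_const]
          filterlim_tendsto_add_at_top[OF tendsto_const, of _ _ "-4", simplified]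
          filterlim_real_sequentially) auto
  then have "filterlim (\<lambda>n. inverse (window n)) at_top sequentially"
    by (rule filterlim_at_top_mono) (use inverse_window_ge in auto)
  from tendsto_inverse_0_at_top[OF this] show ?thesis
    by simp
qed

lemma shrink_mono: "shrink n \<le> shrink (n + 4 * j)"
proof (induction j)
  case (Suc j)
  have "window (n + 4 * j + 4) \<le> window (n + 4 * j)"
    unfolding window_step
    using shrink_le_1 window_pos[of "n + 4 * j"] by (simp add: mult_left_le_one_le less_imp_le)
  then have "shrink (n + 4 * j) \<le> shrink (n + 4 * j + 4)"
    unfolding shrink_def using window_pos B_pos
    by (intro divide_left_mono) (auto intro!: mult_pos_pos add_pos_pos)
  with Suc show ?case by (simp add: add_ac)
qed simp

lemma window_iterate: "window (n + 4 * j) = (\<Prod>i<j. shrink (n + 4 * i)) * window n"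
proof (induction j)
  case (Suc j)
  have "window (n + 4 * Suc j) = shrink (n + 4 * j) * window (n + 4 * j)"
    using window_step[of "n + 4 * j"] by (simp add: add_ac)
  with Suc show ?case by (simp add: mult_ac)
qed simp

text \<open>
  While \<open>n\<close> advances by \<open>4 * k\<close>, the power \<open>u n ^ k\<close> is multiplied \<open>k\<close> times by the first shrink
  factor, whereas the window is multiplied by \<open>k\<close> successive ones, none of which is smaller.
\<close>

lemma power_le_window_step:
  assumes "u n ^ k \<le> C * window n"
  shows "u (n + 4 * k) ^ k \<le> C * window (n + 4 * k)"
proof -
  have "0 < u n ^ k"
    using u_pos by simp
  then have "0 < C * window n"
    using assms by linarith
  have "shrink n ^ k = (\<Prod>i<k. shrink n)"
    by simp
  also have "\<dots> \<le> (\<Prod>i<k. shrink (n + 4 * i))"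
    using shrink_pos[of n] shrink_mono by (intro prod_mono) (auto simp: less_imp_le)
  finally have factors: "shrink n ^ k \<le> (\<Prod>i<k. shrink (n + 4 * i))" .
  have "u (n + 4 * k) ^ k = shrink n ^ k * u n ^ k"
    by (simp add: step power_mult_distrib)
  also have "\<dots> \<le> (\<Prod>i<k. shrink (n + 4 * i)) * (C * window n)"
    using factors assms \<open>0 < u n ^ k\<close> shrink_pos
    by (intro mult_mono) (auto intro!: prod_nonneg simp: less_imp_le)
  also have "\<dots> = C * window (n + 4 * k)"
    unfolding window_iterate by (simp only: mult_ac)
  finally show ?thesis .
qed

lemma power_le_window: "\<exists>C. \<forall>n. u n ^ k \<le> C * window n"
proof -
  \<comment> \<open>A sum of positive terms is a convenient bound for each of the finitely many initial ratios.\<close>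
  define C where "C = (\<Sum>i<4 * k. u i ^ k / window i)"
  have "u n ^ k \<le> C * window n" for n
  proof (induction n rule: less_induct)
    case (less n)
    show ?case
    proof (cases "n < 4 * k")
      case True
      then have "u n ^ k / window n \<le> C"
        unfolding C_def using u_pos window_pos
        by (intro member_le_sum) (auto simp: less_imp_le)
      then show ?thesis
        using window_pos[of n] by (simp add: pos_divide_le_eq)
    next
      case False
      then have "u (n - 4 * k) ^ k \<le> C * window (n - 4 * k)"
        using k_pos by (intro less.IH) simp
      from power_le_window_step[OF this] False show ?thesis
        by simp
    qed
  qed
  then show ?thesis by blast
qed

lemma tendsto_0: "u \<longlonglongrightarrow> 0"
proof -
  obtain C where C: "\<And>n. u n ^ k \<le> C * window n"
    using power_le_window by blast
  have "(\<lambda>n. C * window n) \<longlonglongrightarrow> 0"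
    using tendsto_mult[OF tendsto_const window_tendsto_0, of C] by simp
  then have "(\<lambda>n. u n ^ k) \<longlonglongrightarrow> 0"
    by (rule tendsto_sandwich[OF _ _ tendsto_const, rotated 2])
       (use C u_pos in \<open>auto simp: less_imp_le\<close>)
  then have "(\<lambda>n. root k (u n ^ k)) \<longlonglongrightarrow> root k 0"
    by (rule tendsto_real_root)
  then show ?thesis
    using k_pos u_pos by (simp add: real_root_power_cancel less_imp_le)
qed

end

theorem theorem4p2:
  fixes k :: nat and B :: real
  assumes "k \<ge> 1" and "B \<noteq> 0"
  shows "is_equilibrium (rhs k B) 0 \<and> non_hyperbolic k (rhs k B) 0 \<and>
    (\<forall>u :: nat \<Rightarrow> real. is_solution k (rhs k B) u \<and> (\<forall>i<4 * k. u i > 0) \<and> B > 0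
       \<longrightarrow> u \<longlonglongrightarrow> 0)"
proof (intro conjI allI impI)
  show "is_equilibrium (rhs k B) 0"
    by (rule zero_is_equilibrium)
  show "non_hyperbolic k (rhs k B) 0"
    using assms(1) by (rule zero_non_hyperbolic)
  fix u :: "nat \<Rightarrow> real"
  assume "is_solution k (rhs k B) u \<and> (\<forall>i<4 * k. u i > 0) \<and> B > 0"
  with assms(1) interpret positive_solution k B u
    by unfold_locales auto
  show "u \<longlonglongrightarrow> 0"
    by (rule tendsto_0)
qed

end
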